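(* Let $N$ be a unital, zero-symmetric (right) loop near-ring, and let $R$ be a local ring. Assume there is a local homomorphism $\psi\colon N\to R$. Then $J_2(N)\neq N$, $N$ is a local loop near-ring, and $N/J_2(N)$ is a division ring.
   Context: Loops. A loop is a set $G$ with a binary operation $+$ and an element $0$ such that $0+a=a+0=a$ for all $a\in G$, and for all $a,b\in G$ the equations $a+x=b$ and $y+a=b$ have unique solutions $x,y\in G$. A subloop is a nonempty subset closed under $+$ and under forming the solutions $x,y$ of these equations. A subloop $K$ of $G$ is normal if $a+K=K+a$, $(a+b)+K=a+(b+K)$ and $(K+a)+b=K+(a+b)$ for all $a,b\in G$. Loop near-rings. A (right) loop near-ring is a set $N$ with operations $+,\cdot$ such that $(N,+)$ is a loop, $(N,\cdot)$ is a semigroup, and $(m_1+m_2)n=m_1n+m_2n$ for all $m_1,m_2,n\in N$. It is unital if it has a two-sided multiplicative identity $1$, and zero-symmetric if $n0=0$ for all $n\in N$. An element $u\in N$ is a unit if $uv=vu=1$ for some $v\in N$; $U(N)$ denotes the group of units. Rings are associative and unital (not necessarily commutative); in particular they are unital, zero-symmetric loop near-rings. A local ring is a ring with a unique maximal left ideal. Substructures. A left $N$-subloop of $N$ is a subloop $I$ of $(N,+)$ with $NI\subseteq I$; it is maximal if it is maximal among the left $N$-subloops different from $N$. A left ideal of $N$ is a normal subloop $K$ of $(N,+)$ such that $n(a+k)+K=na+K$ for all $n,a\in N$, $k\in K$ (equivalently, the kernel of a homomorphism of left $N$-modules out of $N$). An ideal is a left ideal $K$ with $KN\subseteq K$; then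 $N/K$ is a loop near-ring under $(n+K)+(m+K)=(n+m)+K$, $(n+K)(m+K)=nm+K$. A left ideal is $N$-maximal if it is a maximal left $N$-subloop. $J_2(N)$ is the intersection of all $N$-maximal left ideals of $N$ (with $J_2(N)=N$ if there are none); it is a two-sided ideal of $N$. A loop near-ring $N$ is local if it has a unique maximal left $N$-subloop. A homomorphism of unital loop near-rings $\psi\colon N\to M$ is a map preserving $+$ and $\cdot$ with $\psi(1)=1$. It is local if $\psi(u)\in U(M)$ implies $u\in U(N)$. *)

theory Defs
  imports "HOL-Algebra.QuotRing"
begin

section \<open>Loops\<close>

locale loop =
  fixes G (structure)
  assumes m_closed: "\<lbrakk>a \<in> carrier G; b \<in> carrier G\<rbrakk> \<Longrightarrow> a \<otimes> b \<in> carrier G"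
    and one_closed: "\<one> \<in> carrier G"
    and l_one: "a \<in> carrier G \<Longrightarrow> \<one> \<otimes> a = a"
    and r_one: "a \<in> carrier G \<Longrightarrow> a \<otimes> \<one> = a"
    and right_solution: "\<lbrakk>a \<in> carrier G; b \<in> carrier G\<rbrakk> \<Longrightarrow> \<exists>!x. x \<in> carrier G \<and> a \<otimes> x = b"
    and left_solution: "\<lbrakk>a \<in> carrier G; b \<in> carrier G\<rbrakk> \<Longrightarrow> \<exists>!y. y \<in> carrier G \<and> y \<otimes> a = b"

locale subloop =
  fixes H and G (structure)
  assumes subset: "H \<subseteq> carrier G"
    and nonempty: "H \<noteq> {}"
    and m_closed: "\<lbrakk>a \<in> H; b \<in> H\<rbrakk> \<Longrightarrow> a \<otimes> b \<in> H"
    and right_solution_closed: "\<lbrakk>a \<in> H; b \<in> H; x \<in> carrier G; a \<otimes> x = b\<rbrakk> \<Longrightarrow> x \<in> H"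
    and left_solution_closed: "\<lbrakk>a \<in> H; b \<in> H; y \<in> carrier G; y \<otimes> a = b\<rbrakk> \<Longrightarrow> y \<in> H"

locale normal_subloop = subloop K G for K and G (structure) +
  assumes coset_eq: "a \<in> carrier G \<Longrightarrow> a <# K = K #> a"
    and l_coset_assoc:
      "\<lbrakk>a \<in> carrier G; b \<in> carrier G\<rbrakk> \<Longrightarrow> (a \<otimes> b) <# K = a <# (b <# K)"
    and r_coset_assoc:
      "\<lbrakk>a \<in> carrier G; b \<in> carrier G\<rbrakk> \<Longrightarrow> (K #> a) #> b = K #> (a \<otimes> b)"


section \<open>Loop near-rings\<close>

text \<open>
  Loop near-rings live on the library's ring records, and the (right) distributive law is the
  only one required. The field \<open>one\<close> of the record is irrelevant unless the near-ring is unital.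
\<close>

locale loop_near_ring =
  fixes N (structure)
  assumes add_loop: "loop (add_monoid N)"
    and mult_closed: "\<lbrakk>m \<in> carrier N; n \<in> carrier N\<rbrakk> \<Longrightarrow> m \<otimes> n \<in> carrier N"
    and mult_assoc:
      "\<lbrakk>l \<in> carrier N; m \<in> carrier N; n \<in> carrier N\<rbrakk> \<Longrightarrow> (l \<otimes> m) \<otimes> n = l \<otimes> (m \<otimes> n)"
    and r_distrib:
      "\<lbrakk>m\<^sub>1 \<in> carrier N; m\<^sub>2 \<in> carrier N; n \<in> carrier N\<rbrakk>
        \<Longrightarrow> (m\<^sub>1 \<oplus> m\<^sub>2) \<otimes> n = m\<^sub>1 \<otimes> n \<oplus> m\<^sub>2 \<otimes> n"

locale unital_loop_near_ring = loop_near_ring +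
  assumes unit_closed: "\<one> \<in> carrier N"
    and unit_left: "n \<in> carrier N \<Longrightarrow> \<one> \<otimes> n = n"
    and unit_right: "n \<in> carrier N \<Longrightarrow> n \<otimes> \<one> = n"

definition zero_symmetric :: "('a, 'm) ring_scheme \<Rightarrow> bool"
  where "zero_symmetric N \<longleftrightarrow> (\<forall>n \<in> carrier N. n \<otimes>\<^bsub>N\<^esub> \<zero>\<^bsub>N\<^esub> = \<zero>\<^bsub>N\<^esub>)"

definition left_subloop :: "'a set \<Rightarrow> ('a, 'm) ring_scheme \<Rightarrow> bool"
  where "left_subloop I N \<longleftrightarrow>
    subloop I (add_monoid N) \<and> (\<forall>n \<in> carrier N. \<forall>i \<in> I. n \<otimes>\<^bsub>N\<^esub> i \<in> I)"

definition maximal_left_subloop :: "'a set \<Rightarrow> ('a, 'm) ring_scheme \<Rightarrow> bool"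
  where "maximal_left_subloop I N \<longleftrightarrow>
    left_subloop I N \<and> I \<noteq> carrier N \<and>
    (\<forall>I'. left_subloop I' N \<and> I' \<noteq> carrier N \<and> I \<subseteq> I' \<longrightarrow> I' = I)"

definition nr_left_ideal :: "'a set \<Rightarrow> ('a, 'm) ring_scheme \<Rightarrow> bool"
  where "nr_left_ideal K N \<longleftrightarrow>
    normal_subloop K (add_monoid N) \<and>
    (\<forall>n \<in> carrier N. \<forall>a \<in> carrier N. \<forall>k \<in> K.
      (n \<otimes>\<^bsub>N\<^esub> (a \<oplus>\<^bsub>N\<^esub> k)) <+\<^bsub>N\<^esub> K = (n \<otimes>\<^bsub>N\<^esub> a) <+\<^bsub>N\<^esub> K)"

definition nr_ideal :: "'a set \<Rightarrow> ('a, 'm) ring_scheme \<Rightarrow> bool"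
  where "nr_ideal K N \<longleftrightarrow>
    nr_left_ideal K N \<and> (\<forall>k \<in> K. \<forall>n \<in> carrier N. k \<otimes>\<^bsub>N\<^esub> n \<in> K)"

definition N_maximal_left_ideal :: "'a set \<Rightarrow> ('a, 'm) ring_scheme \<Rightarrow> bool"
  where "N_maximal_left_ideal K N \<longleftrightarrow> nr_left_ideal K N \<and> maximal_left_subloop K N"

text \<open>Intersecting with the carrier yields the convention for an empty family.\<close>

definition J2 :: "('a, 'm) ring_scheme \<Rightarrow> 'a set"
  where "J2 N = carrier N \<inter> \<Inter> {K. N_maximal_left_ideal K N}"

definition local_loop_near_ring :: "('a, 'm) ring_scheme \<Rightarrow> bool"
  where "local_loop_near_ring N \<longleftrightarrow> loop_near_ring N \<and> (\<exists>!I. maximal_left_subloop I N)"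

definition local_hom ::
    "('a, 'm) ring_scheme \<Rightarrow> ('b, 'n) ring_scheme \<Rightarrow> ('a \<Rightarrow> 'b) set"
  where "local_hom N M =
    {\<psi> \<in> ring_hom N M. \<forall>u \<in> carrier N. \<psi> u \<in> Units M \<longrightarrow> u \<in> Units N}"


section \<open>Local rings and division rings\<close>

definition ring_left_ideal :: "'a set \<Rightarrow> ('a, 'm) ring_scheme \<Rightarrow> bool"
  where "ring_left_ideal I R \<longleftrightarrow>
    additive_subgroup I R \<and> (\<forall>r \<in> carrier R. \<forall>i \<in> I. r \<otimes>\<^bsub>R\<^esub> i \<in> I)"

definition maximal_ring_left_ideal :: "'a set \<Rightarrow> ('a, 'm) ring_scheme \<Rightarrow> bool"
  where "maximal_ring_left_ideal I R \<longleftrightarrow>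
    ring_left_ideal I R \<and> I \<noteq> carrier R \<and>
    (\<forall>I'. ring_left_ideal I' R \<and> I' \<noteq> carrier R \<and> I \<subseteq> I' \<longrightarrow> I' = I)"

locale local_ring = ring +
  assumes unique_maximal_left_ideal: "\<exists>!I. maximal_ring_left_ideal I R"

text \<open>As for the library's fields, the condition on units forces \<open>\<one> \<noteq> \<zero>\<close>.\<close>

locale division_ring = ring +
  assumes division_ring_Units: "Units R = carrier R - {\<zero>}"


section \<open>Quotients by ideals\<close>

text \<open>
  The quotient of a loop near-ring by an ideal \<open>K\<close> is the library's \<open>N Quot K\<close>, whose operations
  are defined on sets without reference to the ring axioms. The facts below state that, on a loop
  near-ring, it consists of the cosets \<open>n + K\<close>, with \<open>(n + K) + (m + K) = (n + m) + K\<close> and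
  \<open>(n + K) (m + K) = n m + K\<close>.
\<close>

lemma (in normal_subloop) coset_absorb:
  assumes "loop G" "a \<in> carrier G" "x \<in> a <# K"
  shows "x \<in> carrier G" "x <# K = a <# K"
proof -
  interpret loop G by fact
  obtain k where k: "k \<in> K" "x = a \<otimes> k" using assms(3) by (auto simp: l_coset_def)
  have kc: "k \<in> carrier G" using k subset by blast
  have "k <# K = K"
  proof
    show "k <# K \<subseteq> K" using k(1) subloop.m_closed[OF subloop_axioms] by (auto simp: l_coset_def)
    show "K \<subseteq> k <# K"
    proof
      fix y assume y: "y \<in> K"
      then obtain z where z: "z \<in> carrier G" "k \<otimes> z = y"
        using right_solution[of k y] kc subset by blast
      then have "z \<in> K" using right_solution_closed k(1) y by blast
      then show "y \<in> k <# K" using z by (auto simp: l_coset_def)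
    qed
  qed
  then show "x <# K = a <# K" using l_coset_assoc[OF assms(2) kc] k(2) by simp
  show "x \<in> carrier G" using k(2) assms(2) kc loop.m_closed[OF assms(1)] by blast
qed

lemma (in normal_subloop) coset_mult:
  assumes "loop G" "a \<in> carrier G" "b \<in> carrier G"
  shows "(a <# K) <#> (b <# K) = (a \<otimes> b) <# K"
proof -
  have *: "x <# (b <# K) = (a \<otimes> b) <# K" if "x \<in> a <# K" for x
  proof -
    note x = coset_absorb[OF assms(1,2) that]
    have xb: "x \<otimes> b \<in> carrier G" "a \<otimes> b \<in> carrier G"
      using x(1) assms loop.m_closed by metis+
    have "x <# (b <# K) = (x \<otimes> b) <# K" using l_coset_assoc x(1) assms(3) by simp
    also have "\<dots> = (K #> x) #> b" using coset_eq[OF xb(1)] r_coset_assoc[OF x(1) assms(3)] by simp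
    also have "\<dots> = (K #> a) #> b" using coset_eq x assms(2) by simp
    also have "\<dots> = (a \<otimes> b) <# K"
      using coset_eq[OF xb(2)] r_coset_assoc[OF assms(2,3)] by simp
    finally show ?thesis .
  qed
  have "(a <# K) <#> (b <# K) = (\<Union>x \<in> a <# K. x <# (b <# K))"
    by (auto simp: set_mult_def l_coset_def)
  moreover have "a <# K \<noteq> {}" using nonempty by (auto simp: l_coset_def)
  ultimately show ?thesis using * by auto
qed

context
  fixes N (structure) and K
  assumes N: "loop_near_ring N" and K: "nr_ideal K N"
begin

private lemma normal_K: "normal_subloop K (add_monoid N)"
  using K by (simp add: nr_ideal_def nr_left_ideal_def)

private lemma loop_N: "loop (add_monoid N)"
  using N by (rule loop_near_ring.add_loop)

private lemma coset_commute: "a \<in> carrier N \<Longrightarrow> K +> a = a <+ K"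
  using normal_subloop.coset_eq[OF normal_K, of a] by (simp add: a_l_coset_def a_r_coset_def)

lemma nr_quot_carrier: "carrier (N Quot K) = {n <+ K | n. n \<in> carrier N}"
proof -
  have "carrier (N Quot K) = (\<Union>n \<in> carrier N. {K +> n})"
    by (simp add: FactRing_simps)
  then show ?thesis using coset_commute by auto
qed

lemma nr_quot_add:
  assumes "n \<in> carrier N" "m \<in> carrier N"
  shows "(n <+ K) \<oplus>\<^bsub>N Quot K\<^esub> (m <+ K) = (n \<oplus> m) <+ K"
  using normal_subloop.coset_mult[OF normal_K loop_N, of n m] assms
  by (simp add: FactRing_def set_add_def a_l_coset_def)

lemma nr_quot_mult:
  assumes "n \<in> carrier N" "m \<in> carrier N"
  shows "(n <+ K) \<otimes>\<^bsub>N Quot K\<^esub> (m <+ K) = (n \<otimes> m) <+ K"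
proof -
  interpret N: loop_near_ring N by (rule N)
  have Kc: "K \<subseteq> carrier N" using subloop.subset[OF normal_subloop.axioms(1)[OF normal_K]] by simp
  have addc: "a \<oplus> b \<in> carrier N" if "a \<in> carrier N" "b \<in> carrier N" for a b
    using loop.m_closed[OF loop_N] that by simp
  have *: "K +> (x \<otimes> y) = (n \<otimes> m) <+ K" if xy: "x \<in> n <+ K" "y \<in> m <+ K" for x y
  proof -
    obtain k l where k: "k \<in> K" "x = n \<oplus> k" and l: "l \<in> K" "y = m \<oplus> l"
      using xy by (auto simp: a_l_coset_def l_coset_def)
    have c: "k \<in> carrier N" "l \<in> carrier N" using k l Kc by auto
    have x: "x \<in> carrier N" and y: "y \<in> carrier N" using k l c assms addc by auto
    have "K +> (x \<otimes> y) = (x \<otimes> y) <+ K" using coset_commute N.mult_closed x y by simp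
    also have "\<dots> = (x \<otimes> m) <+ K"
      using K x l assms by (simp add: nr_ideal_def nr_left_ideal_def)
    also have "x \<otimes> m = n \<otimes> m \<oplus> k \<otimes> m" using k c assms N.r_distrib by simp
    also have "(n \<otimes> m \<oplus> k \<otimes> m) <+ K = (n \<otimes> m) <+ K"
    proof -
      have "k \<otimes> m \<in> K" using K k assms by (simp add: nr_ideal_def)
      then have "n \<otimes> m \<oplus> k \<otimes> m \<in> (n \<otimes> m) <+ K" by (auto simp: a_l_coset_def l_coset_def)
      then show ?thesis
        using normal_subloop.coset_absorb(2)[OF normal_K loop_N, of "n \<otimes> m" "n \<otimes> m \<oplus> k \<otimes> m"]
          N.mult_closed assms by (simp add: a_l_coset_def)
    qed
    finally show ?thesis .
  qed
  have "a <+ K \<noteq> {}" for a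
    using subloop.nonempty[OF normal_subloop.axioms(1)[OF normal_K]]
    by (auto simp: a_l_coset_def l_coset_def)
  then show ?thesis using * by (simp add: FactRing_def rcoset_mult_def)
qed

end

end

theory Submission
  imports Defs
begin

text \<open>
  In a local ring the maximal left ideal \<open>M\<close> is two-sided and consists of the non-units, so a
  local homomorphism \<open>\<psi>\<close> into it composes with the projection to a homomorphism \<open>\<phi>\<close> of \<open>N\<close> into the
  division ring \<open>R / M\<close> whose kernel \<open>K\<close> is exactly the set of non-units of \<open>N\<close>. A left subloop
  containing a unit is everything, hence \<open>K\<close> is the largest proper left subloop, and being an ideal
  it equals \<open>J\<^sub>2(N)\<close>. Since \<open>N / K\<close> embeds into \<open>R / M\<close>, it inherits the ring axioms, and the units of
  \<open>N\<close> provide the inverses.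
\<close>

section \<open>The maximal left ideal of a local ring\<close>

context ring
begin

text \<open>Properness becomes the condition that \<open>\<one>\<close> is missing, which passes to
  unions of chains and so suits Zorn's lemma.\<close>

lemma ring_left_ideal_carrier_iff:
  assumes "ring_left_ideal I R"
  shows "I = carrier R \<longleftrightarrow> \<one> \<in> I"
proof
  assume "\<one> \<in> I"
  then have "r \<in> I" if "r \<in> carrier R" for r
    using assms that r_one[of r] unfolding ring_left_ideal_def by metis
  moreover have "I \<subseteq> carrier R"
    using assms additive_subgroup.a_subset unfolding ring_left_ideal_def by blast
  ultimately show "I = carrier R" by blast
qed simp

text \<open>Two elements of the union lie in comparable members of the chain, hence in a common one,
  where their sum can be formed.\<close>

lemma ring_left_ideal_Union_chain:
  assumes "\<C> \<noteq> {}" and "subset.chain {I. ring_left_ideal I R} \<C>"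
  shows "ring_left_ideal (\<Union>\<C>) R"
proof -
  have li: "ring_left_ideal I R" if "I \<in> \<C>" for I
    using assms(2) that by (auto simp: subset.chain_def)
  have sg: "additive_subgroup I R" if "I \<in> \<C>" for I
    using li[OF that] by (simp add: ring_left_ideal_def)
  have add: "x \<oplus> y \<in> \<Union>\<C>" if xy: "x \<in> \<Union>\<C>" "y \<in> \<Union>\<C>" for x y
  proof -
    obtain I J where IJ: "I \<in> \<C>" "J \<in> \<C>" "x \<in> I" "y \<in> J" using xy by blast
    then have "I \<subseteq> J \<or> J \<subseteq> I" using assms(2) by (auto simp: subset.chain_def)
    then obtain L where "L \<in> \<C>" "x \<in> L" "y \<in> L" using IJ by blast
    then show ?thesis using additive_subgroup.a_closed[OF sg] by blast
  qed
  have "subgroup (\<Union>\<C>) (add_monoid R)"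
  proof (rule add.subgroupI)
    show "\<Union>\<C> \<subseteq> carrier R" using additive_subgroup.a_subset[OF sg] by blast
    show "\<Union>\<C> \<noteq> {}" using assms(1) additive_subgroup.zero_closed[OF sg] by blast
    show "\<ominus> x \<in> \<Union>\<C>" if "x \<in> \<Union>\<C>" for x
      using that additive_subgroup.a_inv_closed[OF sg] by blast
  qed (use add in auto)
  then show ?thesis using li by (auto simp: ring_left_ideal_def additive_subgroup_def)
qed

lemma exists_maximal_ring_left_ideal:
  assumes "ring_left_ideal I R" "\<one> \<notin> I"
  obtains M where "maximal_ring_left_ideal M R" "I \<subseteq> M"
proof -
  let ?A = "{J. ring_left_ideal J R \<and> \<one> \<notin> J \<and> I \<subseteq> J}"
  have "?A \<noteq> {}" using assms by blast
  moreover have "\<Union>\<C> \<in> ?A" if "\<C> \<noteq> {}" "subset.chain ?A \<C>" for \<C>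
  proof -
    have "subset.chain {I. ring_left_ideal I R} \<C>"
      using that(2) by (auto simp: subset.chain_def)
    then show ?thesis
      using ring_left_ideal_Union_chain[OF that(1)] that by (auto simp: subset.chain_def)
  qed
  ultimately have "\<exists>M\<in>?A. \<forall>X\<in>?A. M \<subseteq> X \<longrightarrow> X = M" by (rule subset_Zorn_nonempty)
  then obtain M where M: "M \<in> ?A" and max: "\<And>X. X \<in> ?A \<Longrightarrow> M \<subseteq> X \<Longrightarrow> X = M" by auto
  \<comment> \<open>A proper left ideal above \<open>M\<close> contains \<open>I\<close> and misses
    \<open>\<one>\<close>, so it is in \<open>?A\<close>. Maximality in \<open>?A\<close> is thus
    maximality among all proper left ideals.\<close>
  have "J = M" if J: "ring_left_ideal J R" "J \<noteq> carrier R" "M \<subseteq> J" for J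
    using max[of J] M J ring_left_ideal_carrier_iff[OF J(1)] by auto
  moreover have "M \<noteq> carrier R" using M by auto
  ultimately have "maximal_ring_left_ideal M R"
    using M by (simp add: maximal_ring_left_ideal_def)
  then show thesis using that M by simp
qed

text \<open>This is the principal left ideal \<open>R x\<close>. It misses \<open>\<one>\<close>
  exactly when \<open>x\<close> has no left inverse.\<close>

lemma ring_left_ideal_principal:
  assumes "x \<in> carrier R"
  shows "ring_left_ideal ((\<lambda>r. r \<otimes> x) ` carrier R) R"
proof -
  have "subgroup ((\<lambda>r. r \<otimes> x) ` carrier R) (add_monoid R)"
  proof (rule add.subgroupI)
    fix a assume "a \<in> (\<lambda>r. r \<otimes> x) ` carrier R"
    then obtain r where r: "r \<in> carrier R" "a = r \<otimes> x" by blast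
    show "\<ominus> a \<in> (\<lambda>r. r \<otimes> x) ` carrier R"
      using r assms by (intro image_eqI[of _ _ "\<ominus> r"]) (auto simp: l_minus)
  next
    fix a b assume "a \<in> (\<lambda>r. r \<otimes> x) ` carrier R" "b \<in> (\<lambda>r. r \<otimes> x) ` carrier R"
    then obtain r s where "r \<in> carrier R" "a = r \<otimes> x" "s \<in> carrier R" "b = s \<otimes> x" by blast
    then show "a \<oplus> b \<in> (\<lambda>r. r \<otimes> x) ` carrier R"
      using assms by (intro image_eqI[of _ _ "r \<oplus> s"]) (auto simp: l_distr)
  qed (use assms in auto)
  moreover have "r \<otimes> (s \<otimes> x) \<in> (\<lambda>r. r \<otimes> x) ` carrier R" if "r \<in> carrier R" "s \<in> carrier R" for r s
    using that assms by (intro image_eqI[of _ _ "r \<otimes> s"]) (auto simp: m_assoc)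
  ultimately show ?thesis by (auto simp: ring_left_ideal_def additive_subgroup_def)
qed

end

lemma (in local_ring) maximal_left_ideal_nonunits:
  assumes "maximal_ring_left_ideal M R"
  shows "ideal M R" "M = carrier R - Units R"
proof -
  have li: "ring_left_ideal M R" and proper: "M \<noteq> carrier R"
    using assms by (auto simp: maximal_ring_left_ideal_def)
  interpret M: additive_subgroup M R using li by (simp add: ring_left_ideal_def)
  have lmult: "r \<otimes> x \<in> M" if "r \<in> carrier R" "x \<in> M" for r x
    using li that by (simp add: ring_left_ideal_def)
  have one_notin: "\<one> \<notin> M" using ring_left_ideal_carrier_iff[OF li] proper by blast
  have compl: "\<one> \<ominus> x \<notin> M" if "x \<in> M" for x
  proof
    assume "\<one> \<ominus> x \<in> M"
    then have "(\<one> \<ominus> x) \<oplus> x \<in> M" using that by (rule M.a_closed)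
    moreover have "(\<one> \<ominus> x) \<oplus> x = \<one>" using M.a_Hcarr[OF that] by algebra
    ultimately show False using one_notin by simp
  qed
  \<comment> \<open>Without a left inverse of \<open>x\<close>, the ideal \<open>R x\<close> is
    proper and lies in a maximal left ideal. By uniqueness that is \<open>M\<close>, which then
    contains \<open>x\<close>.\<close>
  have left_inv: "\<exists>y\<in>carrier R. y \<otimes> x = \<one>" if x: "x \<in> carrier R" "x \<notin> M" for x
  proof (rule ccontr)
    assume "\<not> ?thesis"
    then have "\<one> \<notin> (\<lambda>r. r \<otimes> x) ` carrier R" by force
    then obtain M' where "maximal_ring_left_ideal M' R" "(\<lambda>r. r \<otimes> x) ` carrier R \<subseteq> M'"
      using exists_maximal_ring_left_ideal ring_left_ideal_principal[OF x(1)] by blast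
    moreover from this have "M' = M" using unique_maximal_left_ideal assms by blast
    moreover have "x \<in> (\<lambda>r. r \<otimes> x) ` carrier R" using x(1) by (intro image_eqI[of _ _ \<one>]) auto
    ultimately show False using x(2) by blast
  qed
  have unit: "x \<in> Units R" if x: "x \<in> carrier R" "x \<notin> M" for x
  proof -
    obtain y where y: "y \<in> carrier R" "y \<otimes> x = \<one>" using left_inv[OF x] by blast
    \<comment> \<open>Once \<open>y\<close> is outside \<open>M\<close>, it has a left inverse
      \<open>w\<close> as well, and \<open>w = w (y x) = x\<close> makes \<open>x\<close> a
      two-sided unit. If \<open>y\<close> were in \<open>M\<close>, then \<open>1 - x y\<close>
      would have a left inverse; but \<open>(1 - x y) x = x - x (y x) = 0\<close>, which forces
      \<open>x = 0\<close>.\<close>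
    have "y \<notin> M"
    proof
      assume "y \<in> M"
      then have "\<one> \<ominus> x \<otimes> y \<notin> M" using compl lmult x(1) by blast
      then obtain z where z: "z \<in> carrier R" "z \<otimes> (\<one> \<ominus> x \<otimes> y) = \<one>"
        using left_inv[of "\<one> \<ominus> x \<otimes> y"] x(1) y(1) by auto
      have "(\<one> \<ominus> x \<otimes> y) \<otimes> x = x \<ominus> x \<otimes> (y \<otimes> x)"
        using x y(1) by (simp add: a_minus_def l_distr l_minus m_assoc)
      also have "\<dots> = \<zero>" using x(1) y(2) by (simp add: a_minus_def r_neg)
      finally have "z \<otimes> ((\<one> \<ominus> x \<otimes> y) \<otimes> x) = \<zero>" using z(1) by simp
      then have "x = \<zero>" using z x(1) y(1) by (simp flip: m_assoc)
      then show False using x(2) by simp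
    qed
    then obtain w where w: "w \<in> carrier R" "w \<otimes> y = \<one>" using left_inv[OF y(1)] by blast
    have "w = w \<otimes> (y \<otimes> x)" using w(1) y(2) by simp
    also have "\<dots> = x" using w y(1) x(1) by (simp flip: m_assoc)
    finally show ?thesis using w y x(1) by (auto simp: Units_def)
  qed
  have nonunit: "x \<notin> Units R" if "x \<in> M" for x
    using that one_notin lmult unfolding Units_def by fastforce
  show "M = carrier R - Units R" using unit nonunit M.a_subset by blast
  \<comment> \<open>If \<open>a r\<close> is outside \<open>M\<close>, it is a unit, so
    \<open>a\<close> has a right inverse \<open>b\<close>. Since \<open>b a\<close> is in
    \<open>M\<close>, \<open>1 - b a\<close> is a unit; but it is annihilated by \<open>a\<close>
    from the left, so \<open>a = 0\<close>, and \<open>a r = 0\<close> is in \<open>M\<close> after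
    all.\<close>
  have rmult: "a \<otimes> r \<in> M" if a: "a \<in> M" and r: "r \<in> carrier R" for a r
  proof (rule ccontr)
    assume notin: "a \<otimes> r \<notin> M"
    have ac: "a \<in> carrier R" using a by (rule M.a_Hcarr)
    then obtain s where s: "s \<in> carrier R" "(a \<otimes> r) \<otimes> s = \<one>"
      using unit[of "a \<otimes> r"] notin r by (auto simp: Units_def)
    define b where "b = r \<otimes> s"
    have b: "b \<in> carrier R" "a \<otimes> b = \<one>" using ac r s by (auto simp: b_def m_assoc)
    have "\<one> \<ominus> b \<otimes> a \<in> Units R" using unit compl lmult[OF b(1) a] ac b(1) by simp
    then obtain c where c: "c \<in> carrier R" "(\<one> \<ominus> b \<otimes> a) \<otimes> c = \<one>" by (auto simp: Units_def)
    have "a \<otimes> (\<one> \<ominus> b \<otimes> a) = a \<ominus> (a \<otimes> b) \<otimes> a"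
      using ac b(1) by (simp add: a_minus_def r_distr r_minus m_assoc)
    also have "\<dots> = \<zero>" using ac b(2) by (simp add: a_minus_def r_neg)
    finally have "a \<otimes> (\<one> \<ominus> b \<otimes> a) \<otimes> c = \<zero>" using c(1) by simp
    then have "a = \<zero>" using ac b(1) c by (simp add: m_assoc)
    then show False using notin r by simp
  qed
  show "ideal M R"
    by (rule idealI) (use M.a_subgroup lmult rmult in \<open>auto intro: ring_axioms\<close>)
qed


section \<open>Kernels of homomorphisms from loop near-rings to rings\<close>

locale near_ring_to_ring_hom = N: unital_loop_near_ring N + D: ring D
  for N :: "('a, 'm) ring_scheme" (structure) and D :: "('b, 'n) ring_scheme" (structure) +
  fixes \<phi> :: "'a \<Rightarrow> 'b"
  assumes hom: "\<phi> \<in> ring_hom N D"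
begin

definition ker :: "'a set"
  where "ker = {x \<in> carrier N. \<phi> x = \<zero>\<^bsub>D\<^esub>}"

lemma ker_iff: "x \<in> ker \<longleftrightarrow> x \<in> carrier N \<and> \<phi> x = \<zero>\<^bsub>D\<^esub>"
  by (simp add: ker_def)

lemma add_closed: "a \<in> carrier N \<Longrightarrow> b \<in> carrier N \<Longrightarrow> a \<oplus>\<^bsub>N\<^esub> b \<in> carrier N"
  using loop.m_closed[OF N.add_loop] by simp

lemma zero_closed: "\<zero>\<^bsub>N\<^esub> \<in> carrier N"
  using loop.one_closed[OF N.add_loop] by simp

lemma zero_left: "a \<in> carrier N \<Longrightarrow> \<zero>\<^bsub>N\<^esub> \<oplus>\<^bsub>N\<^esub> a = a"
  using loop.l_one[OF N.add_loop] by simp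

lemma right_solution:
  assumes "a \<in> carrier N" "b \<in> carrier N"
  obtains x where "x \<in> carrier N" "a \<oplus>\<^bsub>N\<^esub> x = b"
  using loop.right_solution[OF N.add_loop, of a b] assms by auto

lemma left_solution:
  assumes "a \<in> carrier N" "b \<in> carrier N"
  obtains y where "y \<in> carrier N" "y \<oplus>\<^bsub>N\<^esub> a = b"
  using loop.left_solution[OF N.add_loop, of a b] assms by auto

lemmas hom_add = ring_hom_add[OF hom]

lemmas hom_simps = ring_hom_closed[OF hom] hom_add ring_hom_mult[OF hom] ring_hom_one[OF hom]

text \<open>Preservation of zero is not part of \<open>ring_hom\<close>; it follows by cancelling in
  the additive group of \<open>D\<close>.\<close>

lemma hom_zero: "\<phi> \<zero>\<^bsub>N\<^esub> = \<zero>\<^bsub>D\<^esub>"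
proof -
  have "\<phi> \<zero>\<^bsub>N\<^esub> \<oplus>\<^bsub>D\<^esub> \<phi> \<zero>\<^bsub>N\<^esub> = \<phi> \<zero>\<^bsub>N\<^esub>"
    using zero_closed zero_left by (simp flip: hom_add)
  then show ?thesis using zero_closed by (simp add: hom_simps)
qed

text \<open>Cosets of the kernel are the fibres of \<open>\<phi>\<close>: a point \<open>x\<close>
  of the fibre is \<open>a + k\<close> with \<open>k\<close> solved for in the loop, and
  cancellation in \<open>D\<close> puts \<open>k\<close> into the kernel.\<close>

lemma l_coset_ker:
  assumes "a \<in> carrier N"
  shows "a <+\<^bsub>N\<^esub> ker = {x \<in> carrier N. \<phi> x = \<phi> a}"
proof
  show "a <+\<^bsub>N\<^esub> ker \<subseteq> {x \<in> carrier N. \<phi> x = \<phi> a}"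
    using assms by (auto simp: a_l_coset_def l_coset_def ker_iff hom_simps add_closed)
  show "{x \<in> carrier N. \<phi> x = \<phi> a} \<subseteq> a <+\<^bsub>N\<^esub> ker"
  proof
    fix x assume x: "x \<in> {x \<in> carrier N. \<phi> x = \<phi> a}"
    obtain k where k: "k \<in> carrier N" "a \<oplus>\<^bsub>N\<^esub> k = x" using right_solution x assms by blast
    then have "\<phi> a \<oplus>\<^bsub>D\<^esub> \<phi> k = \<phi> a" using x assms by (simp flip: hom_add)
    then have "k \<in> ker" using k(1) assms by (simp add: ker_iff hom_simps)
    then show "x \<in> a <+\<^bsub>N\<^esub> ker" using k(2) by (auto simp: a_l_coset_def l_coset_def)
  qed
qed

lemma r_coset_ker:
  assumes "a \<in> carrier N"
  shows "ker +>\<^bsub>N\<^esub> a = {x \<in> carrier N. \<phi> x = \<phi> a}"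
proof
  show "ker +>\<^bsub>N\<^esub> a \<subseteq> {x \<in> carrier N. \<phi> x = \<phi> a}"
    using assms by (auto simp: a_r_coset_def r_coset_def ker_iff hom_simps add_closed)
  show "{x \<in> carrier N. \<phi> x = \<phi> a} \<subseteq> ker +>\<^bsub>N\<^esub> a"
  proof
    fix x assume x: "x \<in> {x \<in> carrier N. \<phi> x = \<phi> a}"
    obtain k where k: "k \<in> carrier N" "k \<oplus>\<^bsub>N\<^esub> a = x" using left_solution x assms by blast
    then have "\<phi> k \<oplus>\<^bsub>D\<^esub> \<phi> a = \<phi> a" using x assms by (simp flip: hom_add)
    then have "k \<in> ker" using k(1) assms by (simp add: ker_iff hom_simps)
    then show "x \<in> ker +>\<^bsub>N\<^esub> a" using k(2) by (auto simp: a_r_coset_def r_coset_def)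
  qed
qed

lemma l_coset_ker_eq_iff:
  "a \<in> carrier N \<Longrightarrow> b \<in> carrier N \<Longrightarrow> a <+\<^bsub>N\<^esub> ker = b <+\<^bsub>N\<^esub> ker \<longleftrightarrow> \<phi> a = \<phi> b"
  by (auto simp: l_coset_ker)

lemma subloop_ker: "subloop ker (add_monoid N)"
proof
  show "ker \<noteq> {}" using zero_closed hom_zero by (auto simp: ker_iff)
qed (auto simp: ker_iff add_closed hom_simps)

lemma normal_subloop_ker: "normal_subloop ker (add_monoid N)"
proof -
  \<comment> \<open>An iterated coset translates a fibre other than the kernel, so translation is
    computed for the fibre over an arbitrary \<open>d\<close>. With this and \<open>r\<close>, both
    sides of each normality condition become fibres over the same element of
    \<open>D\<close>.\<close>
  have l: "a <+\<^bsub>N\<^esub> {x \<in> carrier N. \<phi> x = d} = {x \<in> carrier N. \<phi> x = \<phi> a \<oplus>\<^bsub>D\<^esub> d}"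
    if a: "a \<in> carrier N" and d: "d \<in> carrier D" for a d
  proof
    show "{x \<in> carrier N. \<phi> x = \<phi> a \<oplus>\<^bsub>D\<^esub> d} \<subseteq> a <+\<^bsub>N\<^esub> {x \<in> carrier N. \<phi> x = d}"
    proof
      fix x assume x: "x \<in> {x \<in> carrier N. \<phi> x = \<phi> a \<oplus>\<^bsub>D\<^esub> d}"
      obtain k where k: "k \<in> carrier N" "a \<oplus>\<^bsub>N\<^esub> k = x" using right_solution x a by blast
      then have "\<phi> a \<oplus>\<^bsub>D\<^esub> \<phi> k = \<phi> a \<oplus>\<^bsub>D\<^esub> d" using x a by (simp flip: hom_add)
      then have "\<phi> k = d" using k(1) a d by (simp add: hom_simps)
      then show "x \<in> a <+\<^bsub>N\<^esub> {x \<in> carrier N. \<phi> x = d}"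
        using k by (auto simp: a_l_coset_def l_coset_def)
    qed
  qed (use a in \<open>auto simp: a_l_coset_def l_coset_def hom_simps add_closed\<close>)
  have r: "{x \<in> carrier N. \<phi> x = d} +>\<^bsub>N\<^esub> a = {x \<in> carrier N. \<phi> x = d \<oplus>\<^bsub>D\<^esub> \<phi> a}"
    if a: "a \<in> carrier N" and d: "d \<in> carrier D" for a d
  proof
    show "{x \<in> carrier N. \<phi> x = d \<oplus>\<^bsub>D\<^esub> \<phi> a} \<subseteq> {x \<in> carrier N. \<phi> x = d} +>\<^bsub>N\<^esub> a"
    proof
      fix x assume x: "x \<in> {x \<in> carrier N. \<phi> x = d \<oplus>\<^bsub>D\<^esub> \<phi> a}"
      obtain k where k: "k \<in> carrier N" "k \<oplus>\<^bsub>N\<^esub> a = x" using left_solution x a by blast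
      then have "\<phi> k \<oplus>\<^bsub>D\<^esub> \<phi> a = d \<oplus>\<^bsub>D\<^esub> \<phi> a" using x a by (simp flip: hom_add)
      then have "\<phi> k = d" using k(1) a d by (simp add: hom_simps)
      then show "x \<in> {x \<in> carrier N. \<phi> x = d} +>\<^bsub>N\<^esub> a"
        using k by (auto simp: a_r_coset_def r_coset_def)
    qed
  qed (use a in \<open>auto simp: a_r_coset_def r_coset_def hom_simps add_closed\<close>)
  show ?thesis
    by (intro normal_subloop.intro normal_subloop_axioms.intro subloop_ker)
      (simp_all flip: a_l_coset_def a_r_coset_def
        add: l_coset_ker r_coset_ker l r add_closed hom_simps)
qed

text \<open>Both representatives have image \<open>\<phi> n \<otimes> \<phi> a\<close>, because
  \<open>k\<close> maps to zero, so they lie in one fibre.\<close>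

lemma nr_left_ideal_ker: "nr_left_ideal ker N"
proof -
  have "(n \<otimes>\<^bsub>N\<^esub> (a \<oplus>\<^bsub>N\<^esub> k)) <+\<^bsub>N\<^esub> ker = (n \<otimes>\<^bsub>N\<^esub> a) <+\<^bsub>N\<^esub> ker"
    if "n \<in> carrier N" "a \<in> carrier N" "k \<in> ker" for n a k
    using that by (simp add: l_coset_ker_eq_iff N.mult_closed add_closed ker_iff hom_simps)
  then show ?thesis by (simp add: nr_left_ideal_def normal_subloop_ker)
qed

lemma nr_ideal_ker: "nr_ideal ker N"
  by (auto simp: nr_ideal_def nr_left_ideal_ker ker_iff hom_simps N.mult_closed)

lemma left_subloop_ker: "left_subloop ker N"
  using subloop_ker by (auto simp: left_subloop_def ker_iff hom_simps N.mult_closed)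

section \<open>The quotient by the kernel\<close>

lemma quot_add:
  "a \<in> carrier N \<Longrightarrow> b \<in> carrier N \<Longrightarrow>
    (a <+\<^bsub>N\<^esub> ker) \<oplus>\<^bsub>N Quot ker\<^esub> (b <+\<^bsub>N\<^esub> ker) = (a \<oplus>\<^bsub>N\<^esub> b) <+\<^bsub>N\<^esub> ker"
  by (rule nr_quot_add[OF N.loop_near_ring_axioms nr_ideal_ker])

lemma quot_mult:
  "a \<in> carrier N \<Longrightarrow> b \<in> carrier N \<Longrightarrow>
    (a <+\<^bsub>N\<^esub> ker) \<otimes>\<^bsub>N Quot ker\<^esub> (b <+\<^bsub>N\<^esub> ker) = (a \<otimes>\<^bsub>N\<^esub> b) <+\<^bsub>N\<^esub> ker"
  by (rule nr_quot_mult[OF N.loop_near_ring_axioms nr_ideal_ker])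

text \<open>In the library's quotient, zero is the kernel itself and one is a right coset. Both are
  rewritten as left cosets to match the other operations.\<close>

lemma quot_zero: "\<zero>\<^bsub>N Quot ker\<^esub> = \<zero>\<^bsub>N\<^esub> <+\<^bsub>N\<^esub> ker"
  using zero_closed by (simp add: FactRing_def l_coset_ker hom_zero) (simp add: ker_def)

lemma quot_one: "\<one>\<^bsub>N Quot ker\<^esub> = \<one>\<^bsub>N\<^esub> <+\<^bsub>N\<^esub> ker"
  using N.unit_closed by (simp add: FactRing_def l_coset_ker r_coset_ker)

lemma quot_closed: "a \<in> carrier N \<Longrightarrow> a <+\<^bsub>N\<^esub> ker \<in> carrier (N Quot ker)"
  using nr_quot_carrier[OF N.loop_near_ring_axioms nr_ideal_ker] by auto

lemma quot_cases:
  assumes "X \<in> carrier (N Quot ker)"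
  obtains a where "a \<in> carrier N" "X = a <+\<^bsub>N\<^esub> ker"
  using assms nr_quot_carrier[OF N.loop_near_ring_axioms nr_ideal_ker] by auto

lemmas quot_simps =
  quot_add quot_mult quot_zero quot_one quot_closed l_coset_ker_eq_iff hom_simps hom_zero
  add_closed zero_closed N.mult_closed N.unit_closed

text \<open>Equality of cosets is equality of images in \<open>D\<close>. Hence commutativity and
  associativity of addition and left distributivity, which \<open>N\<close> may lack, are inherited
  from \<open>D\<close>.\<close>

lemma ring_quot_ker: "ring (N Quot ker)"
proof (rule ringI)
  show "abelian_group (N Quot ker)"
  proof (rule abelian_groupI)
    fix X assume "X \<in> carrier (N Quot ker)"
    then obtain a where a: "a \<in> carrier N" "X = a <+\<^bsub>N\<^esub> ker" by (rule quot_cases)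
    \<comment> \<open>The additive inverse is the coset of a loop solution of
      \<open>y + a = 0\<close>.\<close>
    obtain y where "y \<in> carrier N" "y \<oplus>\<^bsub>N\<^esub> a = \<zero>\<^bsub>N\<^esub>"
      using left_solution a(1) zero_closed by blast
    then show "\<exists>Y\<in>carrier (N Quot ker). Y \<oplus>\<^bsub>N Quot ker\<^esub> X = \<zero>\<^bsub>N Quot ker\<^esub>"
      using a by (intro bexI[of _ "y <+\<^bsub>N\<^esub> ker"]) (auto simp: quot_add quot_zero quot_closed)
  qed ((elim quot_cases)?; simp add: quot_simps zero_left D.a_ac)+
  show "monoid (N Quot ker)"
    by (rule monoidI) ((elim quot_cases)?; simp add: quot_simps N.unit_left N.unit_right D.m_assoc)+
qed ((elim quot_cases)?; simp add: quot_simps D.l_distr D.r_distr)+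

end


section \<open>Homomorphisms detecting units by non-vanishing\<close>

text \<open>The second assumption says that \<open>\<phi>\<close> is local, in the form needed when \<open>D\<close> is a division ring.\<close>

locale unit_detecting_hom = near_ring_to_ring_hom +
  assumes D_nontrivial: "\<one>\<^bsub>D\<^esub> \<noteq> \<zero>\<^bsub>D\<^esub>"
    and unitI: "x \<in> carrier N \<Longrightarrow> \<phi> x \<noteq> \<zero>\<^bsub>D\<^esub> \<Longrightarrow> x \<in> Units N"
begin

lemma ker_proper: "ker \<noteq> carrier N"
proof -
  have "\<one>\<^bsub>N\<^esub> \<notin> ker" using D_nontrivial by (simp add: ker_iff hom_simps)
  then show ?thesis using N.unit_closed by auto
qed

text \<open>If \<open>v x = 1\<close> for some \<open>x\<close> in \<open>I\<close>, then
  \<open>1\<close> is in \<open>I\<close>, and so is every \<open>n = n 1\<close>. A proper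
  \<open>I\<close> therefore has only non-units, which \<open>\<phi>\<close> sends to zero.\<close>

lemma proper_left_subloop_subset_ker:
  assumes I: "left_subloop I N" and "I \<noteq> carrier N"
  shows "I \<subseteq> ker"
proof
  fix x assume x: "x \<in> I"
  have Ic: "I \<subseteq> carrier N" using subloop.subset[of I "add_monoid N"] I by (simp add: left_subloop_def)
  have mult: "n \<otimes>\<^bsub>N\<^esub> i \<in> I" if "n \<in> carrier N" "i \<in> I" for n i
    using I that by (simp add: left_subloop_def)
  have "x \<notin> Units N"
  proof
    assume "x \<in> Units N"
    then obtain v where "v \<in> carrier N" "v \<otimes>\<^bsub>N\<^esub> x = \<one>\<^bsub>N\<^esub>" by (auto simp: Units_def)
    then have "\<one>\<^bsub>N\<^esub> \<in> I" using mult x by metis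
    then have "n \<in> I" if "n \<in> carrier N" for n using mult[OF that] N.unit_right[OF that] by fastforce
    then show False using Ic assms(2) by blast
  qed
  then show "x \<in> ker" using unitI x Ic by (auto simp: ker_iff)
qed

text \<open>The kernel is a proper left subloop and contains all others, so it is the greatest
  one.\<close>

lemma maximal_left_subloop_iff: "maximal_left_subloop I N \<longleftrightarrow> I = ker"
  using proper_left_subloop_subset_ker left_subloop_ker ker_proper
  unfolding maximal_left_subloop_def by (metis subset_antisym)

lemma J2_eq_ker: "J2 N = ker"
proof -
  have "{K. N_maximal_left_ideal K N} = {ker}"
    using nr_left_ideal_ker by (auto simp: N_maximal_left_ideal_def maximal_left_subloop_iff)
  then show ?thesis by (auto simp: J2_def ker_iff)
qed

lemma local_near_ring: "local_loop_near_ring N"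
  using N.loop_near_ring_axioms by (simp add: local_loop_near_ring_def maximal_left_subloop_iff)

text \<open>A nonzero coset has a representative outside the kernel. This is a unit of
  \<open>N\<close>, and the coset of its inverse is the inverse coset.\<close>

lemma division_ring_quot_ker: "division_ring (N Quot ker)"
proof -
  interpret Q: ring "N Quot ker" by (rule ring_quot_ker)
  have nontrivial: "\<one>\<^bsub>N Quot ker\<^esub> \<noteq> \<zero>\<^bsub>N Quot ker\<^esub>" using D_nontrivial by (simp add: quot_simps)
  have unit: "X \<in> Units (N Quot ker)"
    if X: "X \<in> carrier (N Quot ker)" "X \<noteq> \<zero>\<^bsub>N Quot ker\<^esub>" for X
  proof -
    obtain a where a: "a \<in> carrier N" "X = a <+\<^bsub>N\<^esub> ker" using X(1) by (rule quot_cases)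
    then have "a \<in> Units N" using X(2) unitI by (simp add: quot_simps)
    then obtain v where v: "v \<in> carrier N" "v \<otimes>\<^bsub>N\<^esub> a = \<one>\<^bsub>N\<^esub>" "a \<otimes>\<^bsub>N\<^esub> v = \<one>\<^bsub>N\<^esub>"
      by (auto simp: Units_def)
    let ?V = "v <+\<^bsub>N\<^esub> ker"
    have "?V \<otimes>\<^bsub>N Quot ker\<^esub> X = \<one>\<^bsub>N Quot ker\<^esub>" "X \<otimes>\<^bsub>N Quot ker\<^esub> ?V = \<one>\<^bsub>N Quot ker\<^esub>"
      using a v by (simp_all add: quot_mult quot_one)
    then show ?thesis using X(1) quot_closed[OF v(1)] unfolding Units_def by blast
  qed
  have "\<zero>\<^bsub>N Quot ker\<^esub> \<notin> Units (N Quot ker)"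
    using nontrivial by (auto simp: Units_def)
  then have "Units (N Quot ker) = carrier (N Quot ker) - {\<zero>\<^bsub>N Quot ker\<^esub>}"
    using unit by (auto dest: Q.Units_closed)
  then show ?thesis by unfold_locales
qed

end

section \<open>Passage to the residue ring of the local ring\<close>

theorem corollary3p8:
  fixes N :: "('a, 'm) ring_scheme" and R :: "('b, 'n) ring_scheme" and \<psi> :: "'a \<Rightarrow> 'b"
  assumes "unital_loop_near_ring N" and "zero_symmetric N"
    and "local_ring R"
    and "\<psi> \<in> local_hom N R"
  shows "J2 N \<noteq> carrier N \<and> local_loop_near_ring N \<and> division_ring (N Quot J2 N)"
proof -
  interpret R: local_ring R by fact
  interpret N: unital_loop_near_ring N by fact
  obtain M where M: "maximal_ring_left_ideal M R" using R.unique_maximal_left_ideal by blast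
  interpret M: ideal M R using R.maximal_left_ideal_nonunits(1)[OF M] .
  have nonunits: "M = carrier R - Units R" using R.maximal_left_ideal_nonunits(2)[OF M] .
  have \<psi>: "\<psi> \<in> ring_hom N R" and loc: "\<And>u. u \<in> carrier N \<Longrightarrow> \<psi> u \<in> Units R \<Longrightarrow> u \<in> Units N"
    using assms(4) by (auto simp: local_hom_def)
  \<comment> \<open>The zero of \<open>R Quot M\<close> is the set \<open>M\<close>, and every
    \<open>x\<close> lies in its own coset.\<close>
  have coset_zero: "M +>\<^bsub>R\<^esub> x = \<zero>\<^bsub>R Quot M\<^esub> \<longleftrightarrow> x \<in> M" if "x \<in> carrier R" for x
    using that M.a_rcos_const[of x] M.a_rcos_self[OF that] by (auto simp: FactRing_def)
  define \<phi> where "\<phi> x = M +>\<^bsub>R\<^esub> \<psi> x" for x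
  have "\<phi> \<in> ring_hom N (R Quot M)"
    using ring_hom_trans[OF \<psi> M.rcos_ring_hom] by (simp add: \<phi>_def[abs_def] comp_def)
  moreover have "\<one>\<^bsub>R Quot M\<^esub> \<noteq> \<zero>\<^bsub>R Quot M\<^esub>"
    using coset_zero[of "\<one>\<^bsub>R\<^esub>"] nonunits by (simp add: FactRing_def)
  \<comment> \<open>A nonzero \<open>\<phi> x\<close> means that \<open>\<psi> x\<close> is outside
    \<open>M\<close>, hence a unit of \<open>R\<close>, and locality of \<open>\<psi>\<close> lifts
    this to \<open>x\<close>.\<close>
  moreover have "x \<in> Units N" if "x \<in> carrier N" "\<phi> x \<noteq> \<zero>\<^bsub>R Quot M\<^esub>" for x
    using that coset_zero ring_hom_closed[OF \<psi>] loc nonunits by (auto simp: \<phi>_def)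
  ultimately interpret unit_detecting_hom N "R Quot M" \<phi>
    by (intro unit_detecting_hom.intro near_ring_to_ring_hom.intro unit_detecting_hom_axioms.intro
        near_ring_to_ring_hom_axioms.intro M.quotient_is_ring N.unital_loop_near_ring_axioms)
  show ?thesis
    using ker_proper local_near_ring division_ring_quot_ker by (simp add: J2_eq_ker)
qed

end
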